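(* Let $T$ be the set of targets in a graph with $n$ vertices. There exists an adaptive deterministic algorithm that detects all targets of $T$ with at most $|T|\cdot\log n$ restricted-set queries.
   Context: All logarithms are base $2$. Graphs $G=(V,E)$, $|V|=n$, are connected, simple, undirected, with positive edge weights $w$; $d$ is the shortest-path distance, and $N(v)$ is the set of neighbors of $v$. For $u\in N(v)$, $N(v,u)=\{x\in V: d(v,x)=w(vu)+d(u,x)\}$. $T\subseteq V$ is the nonempty set of unknown targets; its cardinality $|T|$ is known. The restricted-set query at a pair $(v,S)$, where $v\in V$ and $S\subseteq V$ with $T\cap S\ne\emptyset$, returns a vertex $u\in N(v)$ such that $t\in N(v,u)$ for at least one target $t\in T\cap S$; if several such vertices $u$ exist, one of them is returned adversarially. If $v$ is the only target in $S$ (so that no such $u$ exists), the query reveals that $v$ is a target. If $T\cap S=\emptyset$, the query returns adversarially an arbitrary vertex $u\in N(v)$. *)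

theory Defs
  imports Graph_Theory.Graph_Theory
begin

text \<open>
  Answers to a restricted-set query, as seen by the algorithm: either a neighbour, or the
  information that the queried vertex itself is a target.
\<close>

datatype 'v answer = Toward 'v | Is_Target

text \<open>
  Adaptive deterministic algorithms are decision trees: the next query (or the final output)
  is a function of the answers received so far.
\<close>

datatype 'v algorithm =
    Output "'v set"
  | Query 'v "'v set" "'v answer \<Rightarrow> 'v algorithm"

text \<open>
  An undirected edge is a pair of opposite arcs of a \<open>pair_graph\<close> (finite, symmetric, loop-free,
  no parallel arcs); \<open>w\<close> takes the same value on both. Connectedness includes that there is at
  least one vertex.
\<close>

locale weighted_graph = pair_graph G for G :: "'v pair_pre_digraph" +
  fixes w :: "'v \<times> 'v \<Rightarrow> real"
  assumes conn: "connected (with_proj G)"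
    and weight_pos: "e \<in> parcs G \<Longrightarrow> 0 < w e"
    and weight_sym: "(u, v) \<in> parcs G \<Longrightarrow> w (u, v) = w (v, u)"
begin

definition neighbors :: "'v \<Rightarrow> 'v set" where
  "neighbors v = {u. (v, u) \<in> parcs G}"

definition toward :: "'v \<Rightarrow> 'v \<Rightarrow> 'v set" where
  "toward v u = {x \<in> pverts G. \<mu> w v x = ereal (w (v, u)) + \<mu> w u x}"

text \<open>
  The answers the adversary may give to the query \<open>(v, S)\<close> when the target set is \<open>T\<close>.
\<close>

definition answers :: "'v set \<Rightarrow> 'v \<Rightarrow> 'v set \<Rightarrow> 'v answer set" where
  "answers T v S =
    (if T \<inter> S = {} then Toward ` neighbors v
     else if T \<inter> S = {v} then {Is_Target}
     else Toward ` {u \<in> neighbors v. \<exists>t \<in> T \<inter> S. t \<in> toward v u})"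

text \<open>
  \<open>detects_within A T q\<close>: whatever admissible answers are given (possibly depending on the whole
  history), \<open>A\<close> asks at most \<open>q\<close> queries and then outputs exactly \<open>T\<close>.
\<close>

primrec detects_within :: "'v algorithm \<Rightarrow> 'v set \<Rightarrow> nat \<Rightarrow> bool" where
  "detects_within (Output R) T q \<longleftrightarrow> R = T"
| "detects_within (Query v S cont) T q \<longleftrightarrow>
     v \<in> pverts G \<and> S \<subseteq> pverts G \<and> 1 \<le> q \<and>
     (\<forall>a \<in> answers T v S. detects_within (cont a) T (q - 1))"

end

end

theory Submission
  imports Defs "HOL-Library.Discrete_Functions"
begin

text \<open>
  The targets are found one at a time.  Querying a vertex \<open>v\<close> that minimises the sum of the
  distances to the current candidate set \<open>C\<close>, every possible answer \<open>u\<close> leaves at most half of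
  \<open>C\<close> in \<open>toward v u\<close>: otherwise moving from \<open>v\<close> to \<open>u\<close> would decrease the sum.  Since the answer
  certifies a target in \<open>C \<inter> toward v u\<close>, \<open>\<lfloor>log n\<rfloor>\<close> queries isolate one target.  The search
  is then repeated on the vertices not yet identified as targets.
\<close>

context weighted_graph
begin

text \<open>Real-valued so that sums over candidates can be compared and subtracted. Between
  vertices nothing is lost: connectedness and positive weights make \<open>\<mu> w\<close> finite
  there.\<close>

definition dist :: "'v \<Rightarrow> 'v \<Rightarrow> real" where
  "dist v x = real_of_ereal (\<mu> w v x)"

lemma reachable_verts:
  assumes "u \<in> pverts G" "v \<in> pverts G"
  shows "u \<rightarrow>\<^sup>*\<^bsub>with_proj G\<^esub> v"
  using symmetric_connected_imp_strongly_connected[OF pair_sym_arcs conn] assms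
  by (auto simp: strongly_connected_def)

lemma ex_dist_awalk:
  assumes "v \<in> pverts G" "x \<in> pverts G"
  obtains p where "awalk v p x" "dist v x = awalk_cost w p" "\<mu> w v x = ereal (dist v x)"
proof -
  obtain p where "apath v p x" "\<mu> w v x = awalk_cost w p"
    using min_cost_awalk[OF reachable_verts[OF assms], of w] weight_pos by (auto simp: less_imp_le)
  then show thesis
    using that by (auto simp: dist_def apath_def)
qed

lemma dist_le_neighbor:
  assumes "(v, u) \<in> parcs G" "x \<in> pverts G"
  shows "dist v x \<le> w (v, u) + dist u x"
proof -
  have v: "v \<in> pverts G" and u: "u \<in> pverts G"
    using assms in_arcsD1 in_arcsD2 by blast+
  obtain p where p: "awalk u p x" "dist u x = awalk_cost w p"
    using ex_dist_awalk[OF u assms(2)] by blast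
  have "awalk v ((v, u) # p) x"
    using p assms by (simp add: awalk_Cons_iff)
  then have "\<mu> w v x \<le> ereal (awalk_cost w ((v, u) # p))"
    by (rule min_cost_le_walk_cost)
  then show ?thesis
    using p ex_dist_awalk[OF v assms(2)] by (metis awalk_cost_Cons ereal_less_eq(3))
qed

lemma dist_toward:
  assumes "(v, u) \<in> parcs G" "x \<in> toward v u"
  shows "dist v x = w (v, u) + dist u x"
proof -
  have x: "x \<in> pverts G" and eq: "\<mu> w v x = ereal (w (v, u)) + \<mu> w u x"
    using assms(2) by (auto simp: toward_def)
  have "\<mu> w u x = ereal (dist u x)" "\<mu> w v x = ereal (dist v x)"
    using ex_dist_awalk x assms(1) in_arcsD1 in_arcsD2 by metis+
  then show ?thesis
    using eq by simp
qed

lemma median: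
  assumes "C \<subseteq> pverts G"
  obtains v where "v \<in> pverts G"
    "\<And>u. u \<in> neighbors v \<Longrightarrow> 2 * card (C \<inter> toward v u) \<le> card C"
proof -
  have fin: "finite C"
    using assms pair_finite_verts finite_subset by blast
  have "pverts G \<noteq> {}"
    using conn by (auto simp: connected_def strongly_connected_def)
  then obtain v where v: "v \<in> pverts G"
    and min: "\<And>u. u \<in> pverts G \<Longrightarrow> (\<Sum>x\<in>C. dist v x) \<le> (\<Sum>x\<in>C. dist u x)"
    using pair_finite_verts ex_is_arg_min_if_finite[of "pverts G" "\<lambda>v. \<Sum>x\<in>C. dist v x"]
    by (auto simp: is_arg_min_linorder)
  have "2 * card (C \<inter> toward v u) \<le> card C" if "u \<in> neighbors v" for u
  proof -
    have arc: "(v, u) \<in> parcs G" and arc': "(u, v) \<in> parcs G"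
      using that arcs_symmetric by (auto simp: neighbors_def)
    let ?N = "C \<inter> toward v u" and ?c = "w (v, u)"
    \<comment> \<open>Moving from \<open>v\<close> to \<open>u\<close> brings each vertex of
      \<open>toward v u\<close> closer by exactly \<open>?c\<close> and takes any other at most
      \<open>?c\<close> farther away. Minimality of \<open>v\<close> and \<open>?c > 0\<close> then
      give the bound.\<close>
    have "(\<Sum>x\<in>C. dist u x) \<le> (\<Sum>x\<in>C. dist v x + ?c - (if x \<in> toward v u then 2 * ?c else 0))"
      using dist_le_neighbor[OF arc'] dist_toward[OF arc] weight_sym[OF arc] assms
      by (intro sum_mono) (fastforce simp: subset_iff)
    also have "\<dots> = (\<Sum>x\<in>C. dist v x) + card C * ?c - card ?N * (2 * ?c)"
      using fin by (simp add: sum_subtractf sum.distrib sum.If_cases Int_def)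
    finally have "(2 * real (card ?N)) * ?c \<le> card C * ?c"
      using min[of u] arc in_arcsD2 by fastforce
    then show ?thesis
      using weight_pos[OF arc] by (simp del: of_nat_mult add: of_nat_mult[symmetric])
  qed
  with v show thesis
    using that by blast
qed

lemma detects_within_mono:
  "detects_within A T q \<Longrightarrow> q \<le> q' \<Longrightarrow> detects_within A T q'"
proof (induction A arbitrary: q q')
  case (Query v S cont)
  then show ?case
    using diff_le_mono by (auto intro: Query.IH[OF rangeI])
qed simp

text \<open>\<open>B t\<close> is the continuation to run once \<open>t\<close> is known to be a
  target. \<open>A\<close> is fixed before \<open>T\<close> and \<open>q\<close>, as an algorithm
  does not see the targets. The strict bound on \<open>card C\<close> leaves at most one candidate
  at \<open>m = 0\<close>.\<close>

lemma find_target: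
  assumes "C \<subseteq> pverts G" "card C < 2 ^ Suc m"
  shows "\<exists>A. \<forall>T q. T \<inter> C \<noteq> {} \<longrightarrow> (\<forall>t \<in> T \<inter> C. detects_within (B t) T q) \<longrightarrow>
    detects_within A T (m + q)"
  using assms
proof (induction m arbitrary: C)
  case 0
  have "finite C"
    using 0 pair_finite_verts finite_subset by blast
  \<comment> \<open>A sole candidate \<open>c\<close> must be a target, so \<open>B c\<close> is run
    without a query; for empty \<open>C\<close> the claim is vacuous.\<close>
  then have "C = {} \<or> (\<exists>c. C = {c})"
    using 0 by (auto simp: less_2_cases_iff card_1_singleton_iff)
  then show ?case
    by fastforce
next
  case (Suc m)
  obtain v where v: "v \<in> pverts G"
    and half: "\<And>u. u \<in> neighbors v \<Longrightarrow> 2 * card (C \<inter> toward v u) \<le> card C"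
    using median[OF Suc.prems(1)] by blast
  have "\<forall>u \<in> neighbors v. \<exists>A. \<forall>T q. T \<inter> (C \<inter> toward v u) \<noteq> {} \<longrightarrow>
      (\<forall>t \<in> T \<inter> (C \<inter> toward v u). detects_within (B t) T q) \<longrightarrow> detects_within A T (m + q)"
    using Suc.prems half by (intro ballI Suc.IH) force+
  then obtain f where f: "\<And>u T q. u \<in> neighbors v \<Longrightarrow> T \<inter> (C \<inter> toward v u) \<noteq> {} \<Longrightarrow>
      \<forall>t \<in> T \<inter> (C \<inter> toward v u). detects_within (B t) T q \<Longrightarrow> detects_within (f u) T (m + q)"
    by metis
  let ?A = "Query v C (\<lambda>a. case a of Toward u \<Rightarrow> f u | Is_Target \<Rightarrow> B v)"
  show ?case
  proof (intro exI[of _ ?A] allI impI)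
    fix T q
    assume "T \<inter> C \<noteq> {}" and B: "\<forall>t \<in> T \<inter> C. detects_within (B t) T q"
    have "detects_within (B v) T (m + q)" if "T \<inter> C = {v}"
      using B that by (auto intro: detects_within_mono[of _ _ q])
    moreover have "detects_within (f u) T (m + q)"
      if "u \<in> neighbors v" "t \<in> T \<inter> C" "t \<in> toward v u" for u t
      using B that by (intro f) auto
    ultimately show "detects_within ?A T (Suc m + q)"
      using v Suc.prems(1) \<open>T \<inter> C \<noteq> {}\<close> by (auto simp: answers_def)
  qed
qed

text \<open>Induction on the number \<open>j\<close> of targets still missing, with \<open>K\<close>
  the targets already identified; each costs at most \<open>m\<close> queries.\<close>

lemma find_remaining_targets:
  assumes "card (pverts G) < 2 ^ Suc m"
  shows "K \<subseteq> pverts G \<Longrightarrow> \<exists>A. \<forall>T. K \<subseteq> T \<longrightarrow> T \<subseteq> pverts G \<longrightarrow> card T = card K + j \<longrightarrow>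
    detects_within A T (j * m)"
proof (induction j arbitrary: K)
  case 0
  \<comment> \<open>Here the known cardinality tells the algorithm when to stop.\<close>
  have "T = K" if "K \<subseteq> T" "T \<subseteq> pverts G" "card T = card K" for T
    using that pair_finite_verts by (metis card_subset_eq finite_subset)
  then show ?case
    by (intro exI[of _ "Output K"]) auto
next
  case (Suc j)
  \<comment> \<open>Excluding \<open>K\<close> from the candidates ensures that the target found
    next is new.\<close>
  let ?C = "pverts G - K"
  have "\<exists>A. \<forall>T. insert t K \<subseteq> T \<longrightarrow> T \<subseteq> pverts G \<longrightarrow> card T = card (insert t K) + j \<longrightarrow>
      detects_within A T (j * m)" if "t \<in> ?C" for t
    using that Suc.prems by (intro Suc.IH) auto
  then obtain B where B: "\<And>t T. t \<in> ?C \<Longrightarrow> insert t K \<subseteq> T \<Longrightarrow> T \<subseteq> pverts G \<Longrightarrow>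
      card T = card (insert t K) + j \<Longrightarrow> detects_within (B t) T (j * m)"
    by metis
  have "card ?C < 2 ^ Suc m"
    using assms pair_finite_verts by (meson Diff_subset card_mono le_less_trans)
  then obtain A where A: "\<And>T q. T \<inter> ?C \<noteq> {} \<Longrightarrow> \<forall>t \<in> T \<inter> ?C. detects_within (B t) T q \<Longrightarrow>
      detects_within A T (m + q)"
    using find_target[of ?C m B] by blast
  have "detects_within A T (Suc j * m)"
    if T: "K \<subseteq> T" "T \<subseteq> pverts G" "card T = card K + Suc j" for T
  proof -
    have "finite K"
      using Suc.prems pair_finite_verts finite_subset by blast
    then have "detects_within (B t) T (j * m)" if "t \<in> T \<inter> ?C" for t
      using that T by (intro B) auto
    moreover have "T \<inter> ?C \<noteq> {}"
    proof
      assume "T \<inter> ?C = {}"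
      then have "T = K"
        using T by blast
      then show False
        using T(3) by simp
    qed
    ultimately show ?thesis
      using A[of T "j * m"] by simp
  qed
  then show ?case
    by blast
qed

end

theorem theorem11:
  fixes G :: "'v pair_pre_digraph" and w :: "'v \<times> 'v \<Rightarrow> real" and k :: nat
  assumes "weighted_graph G w" and "1 \<le> k"
  shows "\<exists>A. \<forall>T. T \<subseteq> pverts G \<and> card T = k \<longrightarrow>
           (\<exists>q::nat. real q \<le> real k * log 2 (real (card (pverts G))) \<and>
                     weighted_graph.detects_within G w A T q)"
proof -
  interpret weighted_graph G w
    by (rule assms(1))
  let ?n = "card (pverts G)" and ?m = "floor_log (card (pverts G))"
  have n: "0 < ?n"
    using conn pair_finite_verts by (auto simp: card_gt_0_iff connected_def strongly_connected_def)
  have "?n < 2 ^ Suc ?m"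
    using floor_log_exp2_gt[of ?n] by simp
  then obtain A where A: "\<And>T. T \<subseteq> pverts G \<Longrightarrow> card T = k \<Longrightarrow> detects_within A T (k * ?m)"
    using find_remaining_targets[of ?m "{}" k] by auto
  \<comment> \<open>The count is \<open>k * ?m\<close>; rounding the logarithm down keeps it within
    the real bound.\<close>
  have "real (2 ^ ?m) \<le> real ?n"
    using floor_log_exp2_le[OF n] of_nat_le_iff by blast
  then have "real ?m \<le> log 2 (real ?n)"
    using n by (simp add: le_log_of_power)
  then have "real (k * ?m) \<le> real k * log 2 (real ?n)"
    by (simp add: mult_left_mono)
  then show ?thesis
    using A by blast
qed

end
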